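(* Let $\mathcal{G}$ be a Carnot group endowed with a gauge $x\mapsto\|x\|$ such that the unit ball $B_1=\{x:\|x\|<1\}$ has finite horizontal perimeter. Let $u\in L^\infty(\mathcal{G})$ be a nonnegative function with compact support, and let $u^{\star}$ be its rearrangement with respect to the balls $B_r$ and Lebesgue measure. Then $u^{\star}\in BV_{\mathrm{h}}(\mathcal{G})$.
   Context: A Carnot group $\mathcal{G}$ of topological dimension $n$ is a simply connected nilpotent Lie group with stratified Lie algebra $\mathfrak{g}=V_1\oplus\cdots\oplus V_k$, identified with $\mathbb{R}^n$ so that the identity is $0$ and Haar measure is Lebesgue measure $\mathcal{L}^n$. $X_1,\dots,X_m$ are left-invariant vector fields forming a basis of $V_1$ (which generates $\mathfrak{g}$); $\delta_r$ ($r>0$) are the dilations, group automorphisms acting by $r^j$ on $V_j$; $Q=\sum_j j\dim V_j$ is the homogeneous dimension. A gauge is a continuous function $x\mapsto\|x\|\in[0,\infty)$ on $\mathcal{G}$ with $\|x\|=0$ iff $x=0$ and $\|\delta_r x\|=r\|x\|$. Put $B_r=\{x:\|x\|<r\}$ for $r>0$, $B_0=\emptyset$. Rearrangement: for nonnegative measurable $u$ with compact support, $u^{\star}(x)=\tilde\nu_u(\|x\|)$, where $\tilde\nu_u(r)=\sup\{t\ge 0:\mathcal{L}^n(\{u>t\})>\mathcal{L}^n(B_r)\}$ and $\sup\emptyset=0$. A horizontal vector field is $F=\sum_{i=1}^m F^iX_i$, with $|F|^2=\sum_i|F^i|^2$ (the $X_i$ are taken orthonormal). The horizontal gradient is $D_{\mathrm{h}}\phi=\sum_{i=1}^m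 (X_i\phi)X_i$, and $\operatorname{div}_{\mathrm{h}}F$ is defined by $\int\phi\operatorname{div}_{\mathrm{h}}F\,d\mathcal{L}^n=-\int\langle D_{\mathrm{h}}\phi,F\rangle\,d\mathcal{L}^n$ for all compactly supported smooth $\phi$. One says $u\in BV_{\mathrm{h}}(\mathcal{G})$ if $\|u\|_{BV_{\mathrm{h}}(\mathcal{G})}=\sup\int_{\mathcal{G}}u\operatorname{div}_{\mathrm{h}}F\,d\mathcal{L}^n<\infty$, the supremum being over smooth compactly supported horizontal $F$ with $|F|\le1$. The horizontal perimeter of a measurable set $E$ is $\mathcal{P}_{\mathrm{h}}(E)=\|\chi_E\|_{BV_{\mathrm{h}}(\mathcal{G})}$. *)

theory Defs
  imports "HOL-Analysis.Analysis"
begin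

section \<open>Smooth maps between Euclidean spaces\<close>

primrec Ck :: "nat \<Rightarrow> ('a::euclidean_space \<Rightarrow> 'b::euclidean_space) \<Rightarrow> bool" where
  "Ck 0 f \<longleftrightarrow> continuous_on UNIV f"
| "Ck (Suc n) f \<longleftrightarrow>
     (\<forall>x. f differentiable (at x)) \<and> (\<forall>v. Ck n (\<lambda>x. frechet_derivative f (at x) v))"

definition smooth :: "('a::euclidean_space \<Rightarrow> 'b::euclidean_space) \<Rightarrow> bool" where
  "smooth f \<longleftrightarrow> (\<forall>n. Ck n f)"

definition test_function :: "('a::euclidean_space \<Rightarrow> 'b::euclidean_space) \<Rightarrow> bool" where
  "test_function f \<longleftrightarrow> smooth f \<and> compact (closure {x. f x \<noteq> 0})"


section \<open>Carnot groups\<close>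

text \<open>
  A Carnot group of topological dimension \<open>n = DIM('a)\<close> is given by a smooth group law on the
  vector space \<open>'a\<close> (hence a simply connected Lie group) with identity \<open>0\<close>, for which Lebesgue
  measure is a Haar measure. The coordinates are not required to be exponential.
\<close>

locale euclidean_lie_group = group mul 0 ginv
  for mul :: "'a::euclidean_space \<Rightarrow> 'a \<Rightarrow> 'a" and ginv :: "'a \<Rightarrow> 'a" +
  assumes smooth_mul: "smooth (\<lambda>(x, y). mul x y)"
    and smooth_ginv: "smooth ginv"
    and haar: "\<And>x. distr lborel lborel (mul x) = lborel"

text \<open>
  The Lie algebra of left-invariant vector fields is identified with the tangent space \<open>'a\<close> at the
  identity: \<open>left_field mul v\<close> is the left-invariant field whose value at \<open>0\<close> is \<open>v\<close>.
\<close>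

definition left_field :: "('a::euclidean_space \<Rightarrow> 'a \<Rightarrow> 'a) \<Rightarrow> 'a \<Rightarrow> 'a \<Rightarrow> 'a" where
  "left_field mul v x = frechet_derivative (mul x) (at 0) v"

definition field_bracket ::
    "('a::euclidean_space \<Rightarrow> 'a) \<Rightarrow> ('a \<Rightarrow> 'a) \<Rightarrow> 'a \<Rightarrow> 'a" where
  "field_bracket X Y x = frechet_derivative Y (at x) (X x) - frechet_derivative X (at x) (Y x)"

definition lie_bracket :: "('a::euclidean_space \<Rightarrow> 'a \<Rightarrow> 'a) \<Rightarrow> 'a \<Rightarrow> 'a \<Rightarrow> 'a" where
  "lie_bracket mul v w = field_bracket (left_field mul v) (left_field mul w) 0"

definition is_direct_sum :: "nat \<Rightarrow> (nat \<Rightarrow> 'a::euclidean_space set) \<Rightarrow> bool" where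
  "is_direct_sum k V \<longleftrightarrow>
     (\<forall>j\<in>{1..k}. subspace (V j)) \<and>
     (\<forall>x. \<exists>!c. (\<forall>j\<in>{1..k}. c j \<in> V j) \<and> (\<forall>j. j \<notin> {1..k} \<longrightarrow> c j = 0) \<and> x = (\<Sum>j=1..k. c j))"

text \<open>
  The layer conditions say \<open>[V 1, V j] = V (j + 1)\<close> with \<open>V (k + 1) = 0\<close>, which makes the Lie
  algebra nilpotent and generated by \<open>V 1\<close>.
\<close>

definition is_stratification ::
    "('a::euclidean_space \<Rightarrow> 'a \<Rightarrow> 'a) \<Rightarrow> nat \<Rightarrow> (nat \<Rightarrow> 'a set) \<Rightarrow> bool" where
  "is_stratification mul k V \<longleftrightarrow>
     is_direct_sum k V \<and>
     (\<forall>j. 1 \<le> j \<and> j < k \<longrightarrow>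
        span {lie_bracket mul v w | v w. v \<in> V 1 \<and> w \<in> V j} = V (Suc j)) \<and>
     (\<forall>v\<in>V 1. \<forall>w\<in>V k. lie_bracket mul v w = 0)"

definition is_group_automorphism ::
    "('a::euclidean_space \<Rightarrow> 'a \<Rightarrow> 'a) \<Rightarrow> ('a \<Rightarrow> 'a) \<Rightarrow> bool" where
  "is_group_automorphism mul f \<longleftrightarrow>
     bij f \<and> smooth f \<and> smooth (inv f) \<and> (\<forall>x y. f (mul x y) = mul (f x) (f y))"

text \<open>
  The index type \<open>'m\<close> has \<open>m\<close> elements, and \<open>e i\<close> is the value of \<open>X\<^sub>i\<close> at the identity.
\<close>

locale carnot_group = euclidean_lie_group mul ginv
  for mul :: "'a::euclidean_space \<Rightarrow> 'a \<Rightarrow> 'a" and ginv :: "'a \<Rightarrow> 'a" +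
  fixes k :: nat
    and V :: "nat \<Rightarrow> 'a set"
    and e :: "'m::finite \<Rightarrow> 'a"
    and \<delta> :: "real \<Rightarrow> 'a \<Rightarrow> 'a"
  assumes stratified: "is_stratification mul k V"
    and basis: "inj e" "independent (range e)" "span (range e) = V 1"
    and dilation_automorphism: "\<And>r. r > 0 \<Longrightarrow> is_group_automorphism mul (\<delta> r)"
    and dilation_layer: "\<And>r j v. r > 0 \<Longrightarrow> j \<in> {1..k} \<Longrightarrow> v \<in> V j \<Longrightarrow>
           frechet_derivative (\<delta> r) (at 0) v = r ^ j *\<^sub>R v"


section \<open>Gauges and rearrangements\<close>

definition is_gauge :: "(real \<Rightarrow> 'a::euclidean_space \<Rightarrow> 'a) \<Rightarrow> ('a \<Rightarrow> real) \<Rightarrow> bool" where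
  "is_gauge \<delta> N \<longleftrightarrow>
     continuous_on UNIV N \<and> (\<forall>x. 0 \<le> N x) \<and> (\<forall>x. N x = 0 \<longleftrightarrow> x = 0) \<and>
     (\<forall>r>0. \<forall>x. N (\<delta> r x) = r * N x)"

definition gauge_ball :: "('a \<Rightarrow> real) \<Rightarrow> real \<Rightarrow> 'a set" where
  "gauge_ball N r = {x. N x < r}"

text \<open>
  For essentially bounded \<open>u\<close> and \<open>r \<ge> 0\<close> the set of levels below is bounded above, so that the
  real-valued supremum is meaningful; only the empty set needs the explicit convention.
\<close>

definition level_function :: "('a::euclidean_space \<Rightarrow> real) \<Rightarrow> ('a \<Rightarrow> real) \<Rightarrow> real \<Rightarrow> real" where
  "level_function N u r =
     (let T = {t. 0 \<le> t \<and> emeasure lebesgue {x. u x > t} > emeasure lebesgue (gauge_ball N r)}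
      in if T = {} then 0 else Sup T)"

definition rearrangement :: "('a::euclidean_space \<Rightarrow> real) \<Rightarrow> ('a \<Rightarrow> real) \<Rightarrow> 'a \<Rightarrow> real" where
  "rearrangement N u x = level_function N u (N x)"


section \<open>Horizontal bounded variation\<close>

text \<open>
  A horizontal field \<open>\<Sum>\<^sub>i F\<^sup>i X\<^sub>i\<close> is represented by its components \<open>F x :: real ^ 'm\<close>. Since the
  \<open>X\<^sub>i\<close> are orthonormal, its length and scalar products are those of \<open>real ^ 'm\<close>.
\<close>

definition horizontal_gradient ::
    "('a::euclidean_space \<Rightarrow> 'a \<Rightarrow> 'a) \<Rightarrow> ('m::finite \<Rightarrow> 'a) \<Rightarrow> ('a \<Rightarrow> real) \<Rightarrow> 'a \<Rightarrow> real ^ 'm" where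
  "horizontal_gradient mul e \<phi> x =
     (\<chi> i. frechet_derivative \<phi> (at x) (left_field mul (e i) x))"

text \<open>
  The defining identity determines the divergence almost everywhere. For a smooth compactly
  supported field it has a (unique) smooth compactly supported representative, which is the one
  taken here; thus \<open>is_div_h mul e F g\<close> says \<open>g = div\<^sub>h F\<close>.
\<close>

definition is_div_h ::
    "('a::euclidean_space \<Rightarrow> 'a \<Rightarrow> 'a) \<Rightarrow> ('m::finite \<Rightarrow> 'a) \<Rightarrow> ('a \<Rightarrow> real ^ 'm) \<Rightarrow> ('a \<Rightarrow> real) \<Rightarrow> bool"
  where
  "is_div_h mul e F g \<longleftrightarrow>
     test_function g \<and>
     (\<forall>\<phi>. test_function \<phi> \<longrightarrow>
        (\<integral>x. \<phi> x * g x \<partial>lebesgue) = - (\<integral>x. horizontal_gradient mul e \<phi> x \<bullet> F x \<partial>lebesgue))"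

definition bv_h_norm ::
    "('a::euclidean_space \<Rightarrow> 'a \<Rightarrow> 'a) \<Rightarrow> ('m::finite \<Rightarrow> 'a) \<Rightarrow> ('a \<Rightarrow> real) \<Rightarrow> ereal" where
  "bv_h_norm mul e u =
     Sup {ereal (\<integral>x. u x * g x \<partial>lebesgue) | F g.
            test_function F \<and> (\<forall>x. norm (F x) \<le> 1) \<and> is_div_h mul e F g}"

definition locally_integrable :: "('a::euclidean_space \<Rightarrow> real) \<Rightarrow> bool" where
  "locally_integrable u \<longleftrightarrow> (\<forall>K. compact K \<longrightarrow> set_integrable lebesgue K u)"

text \<open>
  Local integrability is what makes the integrals in \<open>bv_h_norm\<close> meaningful (a Bochner integral
  of a non-integrable function is \<open>0\<close>).
\<close>

definition BV_h ::
    "('a::euclidean_space \<Rightarrow> 'a \<Rightarrow> 'a) \<Rightarrow> ('m::finite \<Rightarrow> 'a) \<Rightarrow> ('a \<Rightarrow> real) set" where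
  "BV_h mul e = {u. locally_integrable u \<and> bv_h_norm mul e u < \<infinity>}"

definition perimeter_h ::
    "('a::euclidean_space \<Rightarrow> 'a \<Rightarrow> 'a) \<Rightarrow> ('m::finite \<Rightarrow> 'a) \<Rightarrow> 'a set \<Rightarrow> ereal" where
  "perimeter_h mul e E = bv_h_norm mul e (indicator E)"

end

theory Submission
  imports Defs
begin

text \<open>
  The rearrangement \<open>w = u\<^sup>\<star>\<close> is \<open>f \<circ> N\<close> for the decreasing function \<open>f = level_function N u\<close>. Since \<open>u\<close>
  is bounded, \<open>0 \<le> f \<le> C\<close>; since \<open>u\<close> vanishes off a compact set while the measures of the gauge balls tend to
  that of the whole space, \<open>f\<close> vanishes beyond some radius \<open>R\<close>. Hence all superlevel sets
  \<open>{w > t}\<close> with \<open>t \<ge> 0\<close> are empty or gauge balls, open or closed, of radius at most \<open>R\<close>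
  (\<open>antimono_superlevel\<close>). By the layer-cake formula,
  \<open>\<integral> w div\<^sub>h F = \<integral>\<^sub>0\<^sup>C (\<integral>\<^bsub>{w > t}\<^esub> div\<^sub>h F) dt\<close>
  (\<open>integral_layer_cake_bound\<close>), and it remains to bound the perimeters of the balls
  of radius at most \<open>R\<close> uniformly.
  
  For this, \<open>\<delta> r\<close> maps the unit ball onto the ball of radius \<open>r\<close>, multiplies volume by a constant \<open>J\<close>,
  and divides the divergence of a transported field by \<open>r\<close> (\<open>is_div_h_dilation\<close>), so the perimeter of the
  ball of radius \<open>r\<close> is \<open>J / r\<close> times that of the unit ball. It is well known that \<open>J = r\<^sup>Q\<close>, but the
  following two weaker facts are enough and avoid determinants. That \<open>\<delta> r\<close> multiplies volume by some
  constant is uniqueness of Haar measure (\<open>haar_integral_factorises\<close>, \<open>automorphism_scales_haar\<close>). That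
  \<open>J \<le> const r\<^sup>n\<close> for \<open>r\<close> in a bounded range, where \<open>n\<close> is the topological dimension, follows by comparing
  small Euclidean balls, because the derivative of \<open>\<delta> r\<close> at the identity has norm at most a constant times
  \<open>r\<close> (\<open>automorphism_scaling_lower_bound\<close>, \<open>dilation_derivative_bound\<close>). As \<open>n \<ge> 1\<close>, \<open>J / r\<close>
  stays bounded (\<open>gauge_ball_perimeter_bound\<close>).
\<close>

section \<open>Calculus of smooth maps and test functions\<close>

lemma Ck_SucI:
  assumes "\<And>x. (f has_derivative f' x) (at x)" and "\<And>v. Ck n (\<lambda>x. f' x v)"
  shows "Ck (Suc n) f"
proof -
  have "frechet_derivative f (at x) = f' x" for x
    using assms(1) frechet_derivative_at by metis
  with assms show ?thesis by (auto simp: differentiable_def)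
qed

lemma Ck_SucD:
  assumes "Ck (Suc n) f"
  shows "(f has_derivative frechet_derivative f (at x)) (at x)"
    and "Ck n (\<lambda>x. frechet_derivative f (at x) v)"
  using assms frechet_derivative_works by auto

lemma Ck_imp_continuous: "Ck n f \<Longrightarrow> continuous_on UNIV f"
  by (cases n) (auto intro!: continuous_at_imp_continuous_on differentiable_imp_continuous_within)

lemma Ck_Suc_imp_Ck: "Ck (Suc n) f \<Longrightarrow> Ck n f"
proof (induction n arbitrary: f)
  case 0
  then show ?case using Ck_imp_continuous by (metis Ck.simps(1))
next
  case (Suc n)
  then show ?case by auto
qed

lemma Ck_const: "Ck n (\<lambda>x. c)"
proof (induction n arbitrary: c)
  case (Suc n)
  then show ?case by (intro Ck_SucI[where f' = "\<lambda>x v. 0"]) auto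
qed auto

lemma Ck_add: "Ck n f \<Longrightarrow> Ck n g \<Longrightarrow> Ck n (\<lambda>x. f x + g x)"
proof (induction n arbitrary: f g)
  case (Suc n)
  show ?case
    by (rule Ck_SucI[OF has_derivative_add[OF Ck_SucD(1)[OF Suc.prems(1)] Ck_SucD(1)[OF Suc.prems(2)]]])
      (intro Suc.IH Ck_SucD(2) Suc.prems)
qed (simp add: continuous_on_add)

lemma Ck_sum: "(\<And>i. i \<in> I \<Longrightarrow> Ck n (f i)) \<Longrightarrow> Ck n (\<lambda>x. \<Sum>i\<in>I. f i x)"
  by (induction I rule: infinite_finite_induct) (auto intro: Ck_add Ck_const)

lemma Ck_linear_image: "bounded_linear L \<Longrightarrow> Ck n f \<Longrightarrow> Ck n (\<lambda>x. L (f x))"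
proof (induction n arbitrary: f)
  case 0
  then show ?case by (simp add: bounded_linear.continuous_on)
next
  case (Suc n)
  show ?case
    by (rule Ck_SucI[OF bounded_linear.has_derivative[OF Suc.prems(1) Ck_SucD(1)[OF Suc.prems(2)]]])
      (intro Suc.IH Ck_SucD(2) Suc.prems)
qed

lemma Ck_scaleR: "Ck n a \<Longrightarrow> Ck n f \<Longrightarrow> Ck n (\<lambda>x. a x *\<^sub>R f x)"
proof (induction n arbitrary: a f)
  case (Suc n)
  show ?case
    by (rule Ck_SucI[OF has_derivative_scaleR[OF Ck_SucD(1)[OF Suc.prems(1)] Ck_SucD(1)[OF Suc.prems(2)]]])
      (intro Suc.IH Ck_add Ck_SucD(2)[OF Suc.prems(1)] Ck_SucD(2)[OF Suc.prems(2)]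
        Suc.prems[THEN Ck_Suc_imp_Ck])
qed (simp add: continuous_on_scaleR)

lemma frechet_derivative_expand:
  fixes f :: "'a::euclidean_space \<Rightarrow> 'b::euclidean_space"
  assumes "f differentiable (at x)"
  shows "frechet_derivative f (at x) v = (\<Sum>b\<in>Basis. (v \<bullet> b) *\<^sub>R frechet_derivative f (at x) b)"
proof -
  interpret linear "frechet_derivative f (at x)"
    using assms by (rule linear_frechet_derivative)
  have "frechet_derivative f (at x) v = frechet_derivative f (at x) (\<Sum>b\<in>Basis. (v \<bullet> b) *\<^sub>R b)"
    by (simp add: euclidean_representation)
  then show ?thesis by (simp add: sum scale)
qed

text \<open>
  The derivative \<open>Df (g x) (Dg x v)\<close> has both its base point and its direction depending on \<open>x\<close>, while
  the recursion for \<open>Ck\<close> only speaks of fixed directions. Expanding the direction in the standard basis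
  turns it into a sum of products of scalar functions with fixed directional derivatives of \<open>f\<close>
  composed with \<open>g\<close>, to which the induction hypothesis applies.
\<close>

lemma Ck_compose: "Ck n f \<Longrightarrow> Ck n g \<Longrightarrow> Ck n (\<lambda>x. f (g x))"
proof (induction n arbitrary: f g)
  case 0
  then show ?case by (metis Ck.simps(1) continuous_on_compose2 top_greatest)
next
  case (Suc n)
  let ?Df = "\<lambda>y. frechet_derivative f (at y)" and ?Dg = "\<lambda>x. frechet_derivative g (at x)"
  have "?Df (g x) (?Dg x v) = (\<Sum>b\<in>Basis. (?Dg x v \<bullet> b) *\<^sub>R ?Df (g x) b)" for x v
    using Suc.prems(1) by (intro frechet_derivative_expand) simp
  moreover have "Ck n (\<lambda>x. \<Sum>b\<in>Basis. (?Dg x v \<bullet> b) *\<^sub>R ?Df (g x) b)" for v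
  proof (intro Ck_sum Ck_scaleR)
    show "Ck n (\<lambda>x. ?Dg x v \<bullet> b)" for b
      using Ck_linear_image[OF bounded_linear_inner_left Ck_SucD(2)[OF Suc.prems(2)]] .
    show "Ck n (\<lambda>x. ?Df (g x) b)" for b
      by (rule Suc.IH[OF Ck_SucD(2)[OF Suc.prems(1)] Ck_Suc_imp_Ck[OF Suc.prems(2)]])
  qed
  moreover have "((\<lambda>x. f (g x)) has_derivative (\<lambda>v. ?Df (g x) (?Dg x v))) (at x)" for x
    using diff_chain_at[OF Ck_SucD(1)[OF Suc.prems(2)] Ck_SucD(1)[OF Suc.prems(1)]]
    by (simp add: o_def)
  ultimately show ?case by (intro Ck_SucI) auto
qed

lemma smooth_compose: "smooth f \<Longrightarrow> smooth g \<Longrightarrow> smooth (\<lambda>x. f (g x))"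
  by (simp add: smooth_def Ck_compose)

lemma smooth_has_derivative: "smooth f \<Longrightarrow> (f has_derivative frechet_derivative f (at x)) (at x)"
  using Ck_SucD(1)[of 0 f] unfolding smooth_def by blast

lemma smooth_imp_continuous: "smooth f \<Longrightarrow> continuous_on S f"
  using continuous_on_subset[OF Ck_imp_continuous[of 0 f], of S] unfolding smooth_def by simp

lemma smooth_imp_borel: "smooth f \<Longrightarrow> f \<in> borel_measurable borel"
  by (simp add: borel_measurable_continuous_onI smooth_imp_continuous)

lemma smooth_derivative_continuous:
  assumes "smooth f"
  shows "continuous_on UNIV (\<lambda>x. frechet_derivative f (at x) v)"
  using Ck_imp_continuous[OF Ck_SucD(2)[of 0 f v]] assms unfolding smooth_def by blast

lemma smooth_derivative_joint_continuous:
  assumes f: "smooth f" and w: "continuous_on UNIV w" and p: "continuous_on UNIV p"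
  shows "continuous_on UNIV (\<lambda>x. frechet_derivative f (at (p x)) (w x))"
proof -
  have "f differentiable at y" for y
    using smooth_has_derivative[OF f] by (auto simp: differentiable_def)
  then have eq: "(\<lambda>x. frechet_derivative f (at (p x)) (w x))
      = (\<lambda>x. \<Sum>b\<in>Basis. (w x \<bullet> b) *\<^sub>R frechet_derivative f (at (p x)) b)"
    by (intro ext frechet_derivative_expand)
  have "continuous_on UNIV (\<lambda>x. frechet_derivative f (at (p x)) b)" for b
    by (rule continuous_on_compose2[OF smooth_derivative_continuous[OF f] p]) simp
  then show ?thesis
    unfolding eq by (intro continuous_on_sum continuous_on_scaleR continuous_on_inner w continuous_on_const)
qed

text \<open>
  The support of \<open>F \<circ> h\<close> is the preimage of the support of \<open>F\<close>, hence its image under the continuous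
  map \<open>inv h\<close>.
\<close>

lemma test_function_compose:
  assumes F: "test_function F" and h: "smooth h" "bij h" "smooth (inv h)"
  shows "test_function (\<lambda>x. F (h x))"
proof -
  have "compact (inv h ` closure {x. F x \<noteq> 0})" (is "compact ?K")
    using F h by (intro compact_continuous_image smooth_imp_continuous) (auto simp: test_function_def)
  moreover have "{x. F (h x) \<noteq> 0} \<subseteq> ?K"
  proof
    fix x assume "x \<in> {x. F (h x) \<noteq> 0}"
    then have "h x \<in> closure {x. F x \<noteq> 0}" using closure_subset[of "{x. F x \<noteq> 0}"] by blast
    then show "x \<in> ?K" using h(2) by (metis bij_inv_eq_iff image_eqI)
  qed
  ultimately have "bounded {x. F (h x) \<noteq> 0}"
    using bounded_subset compact_imp_bounded by blast
  then have c: "compact (closure {x. F (h x) \<noteq> 0})"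
    by simp
  have "smooth (\<lambda>x. F (h x))"
    using F h(1) smooth_compose unfolding test_function_def by blast
  with c show ?thesis unfolding test_function_def by blast
qed

lemma test_function_scaleR:
  assumes "test_function F"
  shows "test_function (\<lambda>x. c *\<^sub>R F x)"
proof -
  have "Ck n (\<lambda>x. c *\<^sub>R F x)" for n
  proof (rule Ck_scaleR[OF Ck_const])
    show "Ck n F" using assms unfolding test_function_def smooth_def by blast
  qed
  then have "smooth (\<lambda>x. c *\<^sub>R F x)"
    unfolding smooth_def by blast
  moreover have "{x. c *\<^sub>R F x \<noteq> 0} \<subseteq> {x. F x \<noteq> 0}"
    by auto
  then have "bounded {x. c *\<^sub>R F x \<noteq> 0}"
    using assms bounded_subset unfolding test_function_def compact_closure by blast
  ultimately show ?thesis by (simp add: test_function_def)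
qed

lemma test_function_zero: "test_function (\<lambda>x. 0)"
  by (simp add: test_function_def smooth_def Ck_const)

lemma test_function_integrable:
  fixes f :: "'a::euclidean_space \<Rightarrow> real"
  assumes "test_function f"
  shows "integrable lborel f"
proof -
  let ?K = "closure {x. f x \<noteq> 0}"
  have "set_integrable lborel ?K f"
    unfolding set_integrable_def
    using assms by (intro borel_integrable_compact smooth_imp_continuous) (auto simp: test_function_def)
  moreover have "indicator ?K x *\<^sub>R f x = f x" for x
    using closure_subset[of "{x. f x \<noteq> 0}"] by (auto simp: indicator_def)
  ultimately show ?thesis unfolding set_integrable_def by (simp only:)
qed

section \<open>Left-invariant fields and uniqueness of Haar measure\<close>

lemma frechet_derivative_chain:
  assumes "f differentiable (at (g x))" and "g differentiable (at x)"
  shows "frechet_derivative (\<lambda>x. f (g x)) (at x) v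
    = frechet_derivative f (at (g x)) (frechet_derivative g (at x) v)"
  using frechet_derivative_compose[OF assms(2,1)] by (simp add: o_def)

lemma smooth_differentiable: "smooth f \<Longrightarrow> f differentiable (at x)"
  using smooth_has_derivative differentiableI by blast

lemma open_emeasure_lborel_nonzero:
  fixes S :: "'a::euclidean_space set"
  assumes "open S" "S \<noteq> {}"
  shows "emeasure lborel S \<noteq> 0"
proof -
  have "S \<notin> null_sets lborel"
    using open_not_negligible[OF assms] null_sets_completionI
    unfolding negligible_iff_null_sets by blast
  then show ?thesis
    using assms by (simp add: null_sets_def)
qed

context euclidean_lie_group
begin

lemma mul_has_derivative:
  "(mul x has_derivative (\<lambda>h. frechet_derivative (\<lambda>(x, y). mul x y) (at (x, y)) (0, h))) (at y)"
proof -
  have "(Pair x has_derivative (\<lambda>h. (0, h))) (at y)"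
    by (auto intro!: derivative_eq_intros)
  from diff_chain_at[OF this smooth_has_derivative[OF smooth_mul]]
  show ?thesis by (simp add: o_def)
qed

lemma mul_differentiable: "mul x differentiable (at y)"
  using mul_has_derivative differentiableI by blast

lemma continuous_on_mul:
  "continuous_on S f \<Longrightarrow> continuous_on S g \<Longrightarrow> continuous_on S (\<lambda>x. mul (f x) (g x))"
  using continuous_on_compose2[OF smooth_imp_continuous[OF smooth_mul, of UNIV] continuous_on_Pair]
  by simp

lemma left_field_continuous: "continuous_on UNIV (left_field mul v)"
proof -
  have "left_field mul v = (\<lambda>x. frechet_derivative (\<lambda>(x, y). mul x y) (at (x, 0)) (0, v))"
    unfolding left_field_def using frechet_derivative_at[OF mul_has_derivative] by metis
  then show ?thesis
    using smooth_derivative_joint_continuous[OF smooth_mul, of "\<lambda>x. (0, v)" "\<lambda>x. (x, 0)"]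
    by (simp add: continuous_on_Pair)
qed

lemma automorphism_zero:
  assumes "is_group_automorphism mul f"
  shows "f 0 = 0"
proof -
  have "mul (f 0) (f 0) = mul (f 0) 0"
    using assms unfolding is_group_automorphism_def by (metis right_neutral)
  then show ?thesis using left_cancel by blast
qed

text \<open>
  Differentiate \<open>f (x y) = f x f y\<close> in \<open>y\<close> at the identity: an automorphism carries left-invariant fields
  to left-invariant fields.
\<close>

lemma automorphism_left_field:
  assumes "is_group_automorphism mul f"
  shows "frechet_derivative f (at x) (left_field mul v x)
    = left_field mul (frechet_derivative f (at 0) v) (f x)"
proof -
  have f: "smooth f" and hom: "(\<lambda>y. f (mul x y)) = (\<lambda>y. mul (f x) (f y))"
    using assms by (auto simp: is_group_automorphism_def)
  have "frechet_derivative f (at x) (left_field mul v x)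
      = frechet_derivative (\<lambda>y. f (mul x y)) (at 0) v"
    unfolding left_field_def
    by (subst frechet_derivative_chain) (simp_all add: mul_differentiable smooth_differentiable f)
  also have "\<dots> = left_field mul (frechet_derivative f (at 0) v) (f x)"
    unfolding left_field_def hom
    by (subst frechet_derivative_chain)
      (simp_all add: mul_differentiable smooth_differentiable f automorphism_zero[OF assms])
  finally show ?thesis .
qed

lemma nn_integral_left_translate:
  assumes "h \<in> borel_measurable borel"
  shows "(\<integral>\<^sup>+x. h (mul a x) \<partial>lborel) = (\<integral>\<^sup>+x. h x \<partial>lborel)"
proof -
  have "mul a \<in> borel \<rightarrow>\<^sub>M borel"
    by (intro borel_measurable_continuous_onI continuous_on_mul continuous_intros)
  then show ?thesis
    using assms nn_integral_distr[of "mul a" lborel lborel h] haar[of a] by simp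
qed

lemma mul_borel [measurable]:
  assumes "f \<in> borel_measurable M" "g \<in> borel_measurable M"
  shows "(\<lambda>x. mul (f x) (g x)) \<in> borel_measurable M"
  using borel_measurable_continuous_Pair[OF assms, of mul] smooth_imp_continuous[OF smooth_mul, of UNIV]
  by (simp add: case_prod_beta')

lemma ginv_borel [measurable]: "ginv \<in> borel_measurable borel"
  by (rule smooth_imp_borel[OF smooth_ginv])

text \<open>
  Lebesgue measure is only known to be left invariant, so the measure of a right translate of the unit
  ball may a priori depend on \<open>x\<close>. For the weights in the next lemma it is enough that the translate is
  open and relatively compact.
\<close>

lemma right_translate_ball:
  "(\<integral>\<^sup>+t. indicator (ball 0 1) (mul t x) \<partial>lborel) \<noteq> (0 :: ennreal)" (is "?D \<noteq> 0")
  "(\<integral>\<^sup>+t. indicator (ball 0 1) (mul t x) \<partial>lborel) \<noteq> (\<infinity> :: ennreal)"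
proof -
  let ?V = "(\<lambda>t. mul t x) -` ball 0 1"
  have eq: "?V = (\<lambda>y. mul y (ginv x)) ` ball 0 1"
  proof (intro equalityI subsetI)
    fix t assume "t \<in> ?V"
    then show "t \<in> (\<lambda>y. mul y (ginv x)) ` ball 0 1"
      by (intro image_eqI[where x = "mul t x"]) (simp_all add: assoc)
  qed (auto simp: assoc)
  have "open ?V"
    by (intro open_vimage continuous_on_mul continuous_intros) auto
  then have D: "?D = emeasure lborel ?V"
    using nn_integral_indicator[of ?V lborel] by (simp add: indicator_vimage del: indicator_simps)
  note \<open>open ?V\<close>
  moreover have "?V \<noteq> {}"
    using eq by simp
  ultimately show "?D \<noteq> 0"
    unfolding D by (rule open_emeasure_lborel_nonzero)
  have "compact ((\<lambda>y. mul y (ginv x)) ` cball 0 1)"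
    by (intro compact_continuous_image continuous_on_mul continuous_intros) auto
  moreover have "?V \<subseteq> (\<lambda>y. mul y (ginv x)) ` cball 0 1"
    unfolding eq by (intro image_mono) auto
  ultimately have "bounded ?V"
    using bounded_subset compact_imp_bounded by blast
  then show "?D \<noteq> \<infinity>"
    using D emeasure_bounded_finite[of ?V] by simp
qed

text \<open>
  This is uniqueness of Haar measure, in the form in which the left-invariant measure to be compared
  with Lebesgue measure is the image of Lebesgue measure under \<open>\<theta>\<close>. The second factor depends on \<open>f\<close>
  but not on \<open>\<theta>\<close>; comparing a given \<open>\<theta>\<close> with the identity map therefore shows that the two integrals
  are proportional. With this form of the statement Fubini's theorem is only needed for Lebesgue
  measure.
\<close>

lemma haar_integral_factorises:
  assumes \<theta> [measurable]: "\<theta> \<in> borel_measurable borel"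
    and inv: "\<And>a h. h \<in> borel_measurable borel \<Longrightarrow>
      (\<integral>\<^sup>+x. h (mul a (\<theta> x)) \<partial>lborel) = (\<integral>\<^sup>+x. h (\<theta> x) \<partial>lborel)"
    and [measurable]: "f \<in> borel_measurable borel"
  shows "(\<integral>\<^sup>+x. f (\<theta> x) \<partial>lborel) = (\<integral>\<^sup>+x. indicator (ball 0 1) (\<theta> x) \<partial>lborel) *
    (\<integral>\<^sup>+y. f (ginv y) / (\<integral>\<^sup>+t. indicator (ball 0 1) (mul t (ginv y)) \<partial>lborel) \<partial>lborel)"
proof -
  define g :: "'a \<Rightarrow> ennreal" where "g = indicator (ball 0 1)"
  have [measurable]: "g \<in> borel_measurable borel"
    unfolding g_def by (simp add: borel_measurable_indicator)
  define D where "D x = (\<integral>\<^sup>+t. g (mul t x) \<partial>lborel)" for x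
  \<comment> \<open>Dividing by the total mass in \<open>y\<close> makes \<open>h x y\<close> integrate to \<open>f x\<close> over \<open>y\<close>.\<close>
  define h where "h x y = f x * g (mul y x) / D x" for x y
  have [measurable]: "D \<in> borel_measurable borel"
    unfolding D_def by measurable
  have h [measurable]: "(\<lambda>(x, y). h x y) \<in> borel_measurable (borel \<Otimes>\<^sub>M borel)"
    unfolding h_def by measurable
  have D: "D x \<noteq> 0" "D x \<noteq> \<infinity>" for x
    using right_translate_ball[of x] unfolding D_def g_def by auto
  have "(\<integral>\<^sup>+y. h (\<theta> x) y \<partial>lborel) = f (\<theta> x)" for x
  proof -
    have "(\<integral>\<^sup>+y. h (\<theta> x) y \<partial>lborel) = f (\<theta> x) / D (\<theta> x) * D (\<theta> x)"
      unfolding h_def ennreal_times_divide[symmetric] D_def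
      by (subst nn_integral_cmult[symmetric])
        (auto intro!: nn_integral_cong simp: divide_ennreal_def mult_ac)
    then show ?thesis using D[of "\<theta> x"] by (simp add: ennreal_divide_times ennreal_divide_self top.not_eq_extremum)
  qed
  then have "(\<integral>\<^sup>+x. f (\<theta> x) \<partial>lborel) = (\<integral>\<^sup>+x. \<integral>\<^sup>+y. h (\<theta> x) y \<partial>lborel \<partial>lborel)"
    by simp
  also have "\<dots> = (\<integral>\<^sup>+y. \<integral>\<^sup>+x. h (\<theta> x) y \<partial>lborel \<partial>lborel)"
    by (rule lborel_pair.Fubini') measurable
  \<comment> \<open>Writing \<open>x\<close> for \<open>\<theta> x\<close>, the substitutions \<open>x \<mapsto> y\<inverse> x\<close> and then \<open>y \<mapsto> x y\<close> replace \<open>(x, y)\<close> by \<open>(y\<inverse>, x y)\<close>, which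
      moves \<open>f\<close> to the variable \<open>y\<close> and leaves \<open>g\<close> alone in \<open>x\<close>, since \<open>x y y\<inverse> = x\<close>.\<close>
  also have "\<dots> = (\<integral>\<^sup>+y. \<integral>\<^sup>+x. h (mul (ginv y) (\<theta> x)) y \<partial>lborel \<partial>lborel)"
  proof (rule nn_integral_cong)
    fix y
    show "(\<integral>\<^sup>+x. h (\<theta> x) y \<partial>lborel) = (\<integral>\<^sup>+x. h (mul (ginv y) (\<theta> x)) y \<partial>lborel)"
      by (rule inv[of "\<lambda>x. h x y", symmetric]) measurable
  qed
  also have "\<dots> = (\<integral>\<^sup>+x. \<integral>\<^sup>+y. h (mul (ginv y) (\<theta> x)) y \<partial>lborel \<partial>lborel)"
    by (rule lborel_pair.Fubini') measurable
  also have "\<dots> = (\<integral>\<^sup>+x. \<integral>\<^sup>+y. h (ginv y) (mul (\<theta> x) y) \<partial>lborel \<partial>lborel)"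
  proof (rule nn_integral_cong)
    fix x
    have "mul (ginv (mul (\<theta> x) y)) (\<theta> x) = ginv y" for y
      by (simp add: inverse_distrib_swap assoc)
    then show "(\<integral>\<^sup>+y. h (mul (ginv y) (\<theta> x)) y \<partial>lborel) = (\<integral>\<^sup>+y. h (ginv y) (mul (\<theta> x) y) \<partial>lborel)"
      by (subst nn_integral_left_translate[of "\<lambda>y. h (mul (ginv y) (\<theta> x)) y" "\<theta> x", symmetric]) simp_all
  qed
  also have "\<dots> = (\<integral>\<^sup>+x. g (\<theta> x) * (\<integral>\<^sup>+y. f (ginv y) / D (ginv y) \<partial>lborel) \<partial>lborel)"
  proof (rule nn_integral_cong)
    fix x
    have "h (ginv y) (mul (\<theta> x) y) = g (\<theta> x) * (f (ginv y) / D (ginv y))" for y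
      by (simp add: h_def assoc divide_ennreal_def mult_ac)
    then show "(\<integral>\<^sup>+y. h (ginv y) (mul (\<theta> x) y) \<partial>lborel)
        = g (\<theta> x) * (\<integral>\<^sup>+y. f (ginv y) / D (ginv y) \<partial>lborel)"
      by (simp add: nn_integral_cmult)
  qed
  also have "\<dots> = (\<integral>\<^sup>+x. g (\<theta> x) \<partial>lborel) * (\<integral>\<^sup>+y. f (ginv y) / D (ginv y) \<partial>lborel)"
    by (rule nn_integral_multc) measurable
  finally show ?thesis by (simp add: D_def g_def)
qed

section \<open>Scaling of Lebesgue measure under automorphisms\<close>

text \<open>
  The image of Lebesgue measure under an automorphism is again left invariant, hence a multiple of
  Lebesgue measure. The factor is read off from the unit ball.
\<close>

lemma automorphism_scales_haar:
  assumes f: "is_group_automorphism mul f"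
  obtains c where "c > 0" "distr lborel borel f = density lborel (\<lambda>_. ennreal c)"
proof -
  have smooth: "smooth f" "smooth (inv f)" and bij: "bij f"
    and hom: "f (mul x y) = mul (f x) (f y)" for x y
    using f by (auto simp: is_group_automorphism_def)
  have [measurable]: "f \<in> borel_measurable borel"
    by (rule smooth_imp_borel[OF smooth(1)])
  define K where "K h = (\<integral>\<^sup>+y. h (ginv y) /
    (\<integral>\<^sup>+t. indicator (ball 0 1) (mul t (ginv y)) \<partial>lborel) \<partial>lborel)" for h :: "'a \<Rightarrow> ennreal"
  define B where "B = emeasure lborel (ball (0::'a) 1)"
  define B' where "B' = emeasure lborel (f -` ball 0 1)"
  have preimage: "emeasure lborel (f -` A) = (\<integral>\<^sup>+x. indicator A (f x) \<partial>lborel)"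
    if [measurable]: "A \<in> sets borel" for A
    using nn_integral_indicator[of "f -` A" lborel] measurable_sets[of f borel borel A]
    by (simp add: indicator_vimage del: indicator_simps)
  have "(\<integral>\<^sup>+x. h (mul a (f x)) \<partial>lborel) = (\<integral>\<^sup>+x. h (f x) \<partial>lborel)"
    if [measurable]: "h \<in> borel_measurable borel" for a h
  proof -
    have "mul a (f x) = f (mul (inv f a) x)" for x
      using hom bij by (simp add: bij_is_surj surj_f_inv_f)
    then show ?thesis
      using nn_integral_left_translate[of "\<lambda>x. h (f x)" "inv f a"] by simp
  qed
  from haar_integral_factorises[OF _ this]
  have f_integral: "(\<integral>\<^sup>+x. h (f x) \<partial>lborel) = B' * K h" if "h \<in> borel_measurable borel" for h
    using that by (simp add: K_def B'_def preimage)
  have id_integral: "(\<integral>\<^sup>+x. h x \<partial>lborel) = B * K h" if "h \<in> borel_measurable borel" for h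
    using haar_integral_factorises[of "\<lambda>x. x" h] nn_integral_left_translate that
    by (simp add: K_def B_def)
  have B: "B \<noteq> 0" "B \<noteq> \<infinity>"
    unfolding B_def using less_imp_neq[OF unit_ball_vol_pos[of "real DIM('a)"]] by (simp_all add: emeasure_ball)
  have "f -` ball 0 1 = inv f ` ball 0 1"
    using bij by (simp add: bij_vimage_eq_inv_image)
  also have "\<dots> \<subseteq> inv f ` cball 0 1"
    by (intro image_mono) auto
  finally have "bounded (f -` ball 0 1)"
    by (rule bounded_subset[rotated])
      (intro compact_imp_bounded compact_continuous_image smooth_imp_continuous smooth compact_cball)
  then have B'_fin: "B' \<noteq> \<infinity>"
    using emeasure_bounded_finite[of "f -` ball 0 1"] unfolding B'_def by simp
  have op: "open (f -` ball 0 1)"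
    by (intro open_vimage smooth_imp_continuous smooth) auto
  have "0 \<in> f -` ball 0 1"
    using automorphism_zero[OF f] by simp
  with op have B'_pos: "B' \<noteq> 0"
    unfolding B'_def by (intro open_emeasure_lborel_nonzero) auto
  define c where "c = enn2real (B' / B)"
  have c: "ennreal c = B' / B"
    unfolding c_def using B B'_fin
    by (intro ennreal_enn2real) (simp add: ennreal_divide_eq_top_iff top.not_eq_extremum[symmetric])
  have "c > 0"
  proof -
    have "B' / B \<noteq> 0" using B B'_pos by (simp add: ennreal_divide_eq_0_iff)
    then show ?thesis using c by (metis ennreal_neg not_less)
  qed
  moreover have "distr lborel borel f = density lborel (\<lambda>_. ennreal c)"
  proof (rule measure_eqI)
    fix A assume "A \<in> sets (distr lborel borel f)"
    then have A [measurable]: "A \<in> sets borel" by simp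
    have "emeasure (distr lborel borel f) A = B' * K (indicator A)"
      using f_integral[of "indicator A"] preimage[of A] by (simp add: emeasure_distr)
    also have "B' = ennreal c * B"
      using c B by (simp add: ennreal_divide_times ennreal_divide_self top.not_eq_extremum)
    also have "ennreal c * B * K (indicator A) = ennreal c * emeasure lborel A"
      using id_integral[of "indicator A"] by (simp add: mult_ac)
    also have "\<dots> = emeasure (density lborel (\<lambda>_. ennreal c)) A"
      by (simp add: emeasure_density_const)
    finally show "emeasure (distr lborel borel f) A = emeasure (density lborel (\<lambda>_. ennreal c)) A" .
  qed simp
  ultimately show ?thesis using that by blast
qed

text \<open>
  The factor \<open>c\<close> is the inverse of the absolute Jacobian determinant of \<open>f\<close> at \<open>0\<close>, so the inequality is
  \<open>\<bar>det Df(0)\<bar> \<le> (2 L)\<^sup>n\<close>. It is obtained by measuring small balls: near the identity \<open>f\<close> is at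
  most \<open>2 L\<close>-expanding, one \<open>L\<close> accounting for the derivative and the other for the error of
  linearisation.
\<close>

lemma automorphism_scaling_lower_bound:
  assumes f: "is_group_automorphism mul f"
    and c: "c > 0" "distr lborel borel f = density lborel (\<lambda>_. ennreal c)"
    and L: "L > 0" "\<And>v. norm (frechet_derivative f (at 0) v) \<le> L * norm v"
  shows "1 \<le> c * (2 * L) ^ DIM('a)"
proof -
  have smooth: "smooth f"
    using f by (auto simp: is_group_automorphism_def)
  from smooth_has_derivative[OF this, of 0] obtain d where d: "d > 0"
    "\<And>y. norm y < d \<Longrightarrow> norm (f y - frechet_derivative f (at 0) y) \<le> L * norm y"
    unfolding has_derivative_at_alt using L(1) automorphism_zero[OF f] by auto
  have "ball 0 d \<subseteq> f -` ball 0 (2 * L * d)"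
  proof
    fix y :: 'a assume "y \<in> ball 0 d"
    then have y: "norm y < d" by simp
    have "norm (f y) \<le> norm (f y - frechet_derivative f (at 0) y) + norm (frechet_derivative f (at 0) y)"
      by (metis add.commute norm_triangle_sub)
    also have "\<dots> \<le> 2 * L * norm y"
      using d(2)[OF y] L(2)[of y] by simp
    also have "\<dots> < 2 * L * d"
      using y L(1) by simp
    finally show "y \<in> f -` ball 0 (2 * L * d)" by simp
  qed
  moreover have [measurable]: "f \<in> borel_measurable borel"
    by (rule smooth_imp_borel[OF smooth])
  moreover have "f -` ball 0 (2 * L * d) \<in> sets borel"
    using measurable_sets[of f borel borel "ball 0 (2 * L * d)"] by simp
  ultimately have "emeasure lborel (ball (0::'a) d) \<le> emeasure (distr lborel borel f) (ball 0 (2 * L * d))"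
    by (subst emeasure_distr) (auto intro!: emeasure_mono)
  also have "\<dots> = ennreal c * emeasure lborel (ball (0::'a) (2 * L * d))"
    unfolding c(2) by (simp add: emeasure_density_const)
  finally have "ennreal (unit_ball_vol (real DIM('a)) * d ^ DIM('a))
      \<le> ennreal (c * (unit_ball_vol (real DIM('a)) * (2 * L * d) ^ DIM('a)))"
    using d L c by (simp add: emeasure_ball ennreal_mult)
  then have "unit_ball_vol (real DIM('a)) * d ^ DIM('a)
      \<le> c * (unit_ball_vol (real DIM('a)) * (2 * L * d) ^ DIM('a))"
    using c d L by (subst (asm) ennreal_le_iff) (auto intro!: mult_nonneg_nonneg)
  also have "\<dots> = (unit_ball_vol (real DIM('a)) * d ^ DIM('a)) * (c * (2 * L) ^ DIM('a))"
    by (simp add: power_mult_distrib)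
  finally show ?thesis
    using d(1) unit_ball_vol_pos[of "real DIM('a)"] by simp
qed

lemma automorphism_integral:
  fixes h :: "'a \<Rightarrow> real"
  assumes f: "is_group_automorphism mul f"
    and c: "c > 0" "distr lborel borel f = density lborel (\<lambda>_. ennreal c)"
    and [measurable]: "h \<in> borel_measurable borel"
  shows "(\<integral>x. h (f x) \<partial>lebesgue) = c * (\<integral>x. h x \<partial>lebesgue)"
proof -
  have [measurable]: "f \<in> borel_measurable borel"
    using f smooth_imp_borel by (auto simp: is_group_automorphism_def)
  have "(\<integral>x. h (f x) \<partial>lborel) = (\<integral>x. h x \<partial>distr lborel borel f)"
    by (rule integral_distr[symmetric]) simp_all
  also have "\<dots> = c * (\<integral>x. h x \<partial>lborel)"
    unfolding c(2) using c(1) by (subst integral_density) simp_all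
  finally show ?thesis
    by (simp add: integral_completion)
qed

lemma horizontal_gradient_borel:
  assumes "smooth \<phi>"
  shows "horizontal_gradient mul e \<phi> \<in> borel_measurable borel"
  unfolding horizontal_gradient_def
  using smooth_derivative_joint_continuous[OF assms left_field_continuous, of "\<lambda>x. x"]
  by (intro borel_measurable_continuous_onI continuous_on_vec_lambda) simp

end

section \<open>Dilations and the perimeter of gauge balls\<close>

lemma gauge_ball_borel:
  assumes "is_gauge \<delta> N"
  shows "gauge_ball N r \<in> sets borel"
proof -
  have "open (N -` {..<r})"
    using assms by (intro open_vimage) (auto simp: is_gauge_def)
  then show ?thesis by (simp add: gauge_ball_def vimage_def)
qed

context carnot_group
begin

text \<open>
  If \<open>k\<close> were \<open>0\<close>, the direct sum of the layers would be trivial, whereas a Euclidean space has positive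
  dimension.
\<close>

lemma first_layer: "1 \<in> {1..k}" "e i \<in> V 1"
proof -
  have "k \<noteq> 0"
  proof
    assume "k = 0"
    then have "x = 0" for x :: 'a
      using stratified by (force simp: is_stratification_def is_direct_sum_def)
    moreover obtain b :: 'a where "b \<in> Basis"
      using nonempty_Basis by blast
    ultimately show False using nonzero_Basis by metis
  qed
  then show "1 \<in> {1..k}" by simp
  show "e i \<in> V 1"
    using basis(3) span_base[of "e i" "range e"] by auto
qed

text \<open>
  On \<open>V j\<close> the derivative is multiplication by \<open>r ^ j\<close> with \<open>j \<ge> 1\<close>, and \<open>r ^ j\<close> is at most a constant
  times \<open>r\<close> as long as \<open>r\<close> stays bounded. The layers are not assumed orthogonal, so the constant
  \<open>C\<close> collects the norms of the components \<open>c b j \<in> V j\<close> of the standard basis vectors \<open>b\<close>.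
\<close>

lemma dilation_derivative_bound:
  assumes "R > 0"
  obtains C where "C > 0"
    "\<And>r v. 0 < r \<Longrightarrow> r \<le> R \<Longrightarrow> norm (frechet_derivative (\<delta> r) (at 0) v) \<le> C * r * norm v"
proof -
  define c where "c b = (SOME c. (\<forall>j\<in>{1..k}. c j \<in> V j) \<and> b = (\<Sum>j=1..k. c j))" for b
  have "\<exists>c. (\<forall>j\<in>{1..k}. c j \<in> V j) \<and> b = (\<Sum>j=1..k. c j)" for b
    using stratified unfolding is_stratification_def is_direct_sum_def by meson
  from someI_ex[OF this] have c: "\<And>b j. j \<in> {1..k} \<Longrightarrow> c b j \<in> V j" "\<And>b. b = (\<Sum>j=1..k. c b j)"
    unfolding c_def by blast+
  define S where "S = max 1 R"
  define C where "C = 1 + (\<Sum>b\<in>Basis. \<Sum>j=1..k. S ^ k * norm (c b j))"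
  have S: "S \<ge> 1" "S \<ge> R" by (simp_all add: S_def)
  have "norm (frechet_derivative (\<delta> r) (at 0) v) \<le> C * r * norm v" if r: "0 < r" "r \<le> R" for r v
  proof -
    let ?D = "frechet_derivative (\<delta> r) (at 0)"
    have diff: "\<delta> r differentiable (at 0)"
      using dilation_automorphism[OF r(1)] by (intro smooth_differentiable) (auto simp: is_group_automorphism_def)
    interpret D: linear ?D
      using diff by (rule linear_frechet_derivative)
    have "r ^ j \<le> r * S ^ k" if j: "j \<in> {1..k}" for j
    proof -
      obtain i where i: "j = Suc i" "i \<le> k" using j by (cases j) auto
      have "r ^ i \<le> S ^ i" using r S by (intro power_mono) auto
      also have "\<dots> \<le> S ^ k" using S i by (intro power_increasing) auto
      finally show ?thesis using r i by simp
    qed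
    then have summand_bound: "norm (r ^ j *\<^sub>R c b j) \<le> r * (S ^ k * norm (c b j))" if "j \<in> {1..k}" for b j
      using that r mult_right_mono[of "r ^ j" "r * S ^ k" "norm (c b j)"] by (simp add: mult.assoc)
    have basis_bound: "norm (?D b) \<le> r * (\<Sum>j=1..k. S ^ k * norm (c b j))" for b
    proof -
      have "?D b = (\<Sum>j=1..k. r ^ j *\<^sub>R c b j)"
        by (subst c(2)[of b]) (simp add: D.sum dilation_layer[OF r(1)] c(1))
      also have "norm \<dots> \<le> (\<Sum>j=1..k. r * (S ^ k * norm (c b j)))"
        by (intro order_trans[OF norm_sum] sum_mono summand_bound)
      finally show ?thesis by (simp add: sum_distrib_left)
    qed
    have "norm (?D v) = norm (\<Sum>b\<in>Basis. (v \<bullet> b) *\<^sub>R ?D b)"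
      by (subst frechet_derivative_expand[OF diff]) simp
    also have "\<dots> \<le> (\<Sum>b\<in>Basis. norm v * (r * (\<Sum>j=1..k. S ^ k * norm (c b j))))"
      by (intro order_trans[OF norm_sum] sum_mono, unfold norm_scaleR,
          intro mult_mono Basis_le_norm basis_bound norm_ge_zero)
    also have "\<dots> = norm v * r * (C - 1)"
      by (simp add: C_def sum_distrib_left mult.assoc)
    also have "\<dots> \<le> C * r * norm v"
      using r by (simp add: algebra_simps)
    finally show ?thesis .
  qed
  moreover have "C > 0"
    unfolding C_def using S by (intro add_pos_nonneg sum_nonneg) auto
  ultimately show ?thesis using that by blast
qed

text \<open>
  The horizontal fields come from the first layer, on which the dilation acts as multiplication by
  \<open>r\<close>. Consequently its derivative maps \<open>X\<^sub>i\<close> at \<open>x\<close> to \<open>r X\<^sub>i\<close> at \<open>\<delta> r x\<close>.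
\<close>

lemma horizontal_gradient_dilation:
  assumes r: "r > 0" and \<psi>: "smooth \<psi>"
  shows "horizontal_gradient mul e (\<lambda>x. \<psi> (\<delta> r x)) x
    = r *\<^sub>R horizontal_gradient mul e \<psi> (\<delta> r x)"
proof -
  note aut = dilation_automorphism[OF r]
  have "frechet_derivative (\<lambda>x. \<psi> (\<delta> r x)) (at x) (left_field mul (e i) x)
      = r * frechet_derivative \<psi> (at (\<delta> r x)) (left_field mul (e i) (\<delta> r x))" for i
  proof -
    have "smooth (\<delta> r)"
      using aut by (auto simp: is_group_automorphism_def)
    then have "frechet_derivative (\<lambda>x. \<psi> (\<delta> r x)) (at x) (left_field mul (e i) x)
        = frechet_derivative \<psi> (at (\<delta> r x)) (left_field mul (r *\<^sub>R e i) (\<delta> r x))"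
      using dilation_layer[OF r first_layer]
      by (subst frechet_derivative_chain)
        (simp_all add: smooth_differentiable \<psi> automorphism_left_field[OF aut])
    also have "left_field mul (r *\<^sub>R e i) (\<delta> r x) = r *\<^sub>R left_field mul (e i) (\<delta> r x)"
      unfolding left_field_def
      using linear_frechet_derivative[OF mul_differentiable] by (simp add: linear_cmul)
    also have "frechet_derivative \<psi> (at (\<delta> r x)) \<dots>
        = r * frechet_derivative \<psi> (at (\<delta> r x)) (left_field mul (e i) (\<delta> r x))"
      using linear_frechet_derivative[OF smooth_differentiable[OF \<psi>]] by (simp add: linear_cmul)
    finally show ?thesis .
  qed
  then show ?thesis by (simp add: horizontal_gradient_def vec_eq_iff)
qed

text \<open>
  A test function for the dilated field is pulled back to one for \<open>F\<close> by \<open>inv (\<delta> r)\<close>. The measure factor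
  \<open>c\<close> occurs on both sides and the gradient contributes the factor \<open>r\<close>.
\<close>

lemma is_div_h_dilation:
  assumes r: "r > 0" and F: "test_function F" and g: "is_div_h mul e F g"
  shows "is_div_h mul e (\<lambda>x. F (\<delta> r x)) (\<lambda>x. r * g (\<delta> r x))"
proof -
  note aut = dilation_automorphism[OF r]
  then have \<delta>: "smooth (\<delta> r)" "bij (\<delta> r)" "smooth (inv (\<delta> r))"
    by (auto simp: is_group_automorphism_def)
  obtain c where c: "c > 0" "distr lborel borel (\<delta> r) = density lborel (\<lambda>_. ennreal c)"
    using automorphism_scales_haar[OF aut] .
  have g_test: "test_function g"
    using g by (simp add: is_div_h_def)
  have [measurable]: "g \<in> borel_measurable borel" "F \<in> borel_measurable borel"
    using g_test F smooth_imp_borel by (auto simp: test_function_def)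
  have "(\<integral>x. \<phi> x * (r * g (\<delta> r x)) \<partial>lebesgue)
      = - (\<integral>x. horizontal_gradient mul e \<phi> x \<bullet> F (\<delta> r x) \<partial>lebesgue)"
    if \<phi>: "test_function \<phi>" for \<phi>
  proof -
    define \<psi> where "\<psi> x = \<phi> (inv (\<delta> r) x)" for x
    have \<psi>: "test_function \<psi>"
      using test_function_compose[OF \<phi>, of "inv (\<delta> r)"] \<delta>
      by (simp add: bij_imp_bij_inv inv_inv_eq \<psi>_def[abs_def])
    then have \<psi>_smooth: "smooth \<psi>" by (simp add: test_function_def)
    have \<phi>_eq: "\<phi> = (\<lambda>x. \<psi> (\<delta> r x))"
      using \<delta>(2) by (simp add: \<psi>_def bij_is_inj inv_f_f)
    have [measurable]: "\<psi> \<in> borel_measurable borel" "horizontal_gradient mul e \<psi> \<in> borel_measurable borel"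
      by (rule smooth_imp_borel horizontal_gradient_borel, rule \<psi>_smooth)+
    have "(\<integral>x. \<phi> x * (r * g (\<delta> r x)) \<partial>lebesgue) = r * (\<integral>x. \<psi> (\<delta> r x) * g (\<delta> r x) \<partial>lebesgue)"
      unfolding \<phi>_eq by (subst integral_mult_right_zero[symmetric]) (simp add: mult_ac)
    also have "\<dots> = r * (c * (\<integral>x. \<psi> x * g x \<partial>lebesgue))"
      by (subst automorphism_integral[OF aut c, of "\<lambda>x. \<psi> x * g x"]) simp_all
    also have "(\<integral>x. \<psi> x * g x \<partial>lebesgue) = - (\<integral>x. horizontal_gradient mul e \<psi> x \<bullet> F x \<partial>lebesgue)"
      using g \<psi> by (simp add: is_div_h_def)
    also have "r * (c * - (\<integral>x. horizontal_gradient mul e \<psi> x \<bullet> F x \<partial>lebesgue))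
        = - (r * (\<integral>x. horizontal_gradient mul e \<psi> (\<delta> r x) \<bullet> F (\<delta> r x) \<partial>lebesgue))"
      by (subst automorphism_integral[OF aut c, of "\<lambda>x. horizontal_gradient mul e \<psi> x \<bullet> F x"]) simp_all
    also have "\<dots> = - (\<integral>x. horizontal_gradient mul e \<phi> x \<bullet> F (\<delta> r x) \<partial>lebesgue)"
      unfolding \<phi>_eq horizontal_gradient_dilation[OF r \<psi>_smooth] by simp
    finally show ?thesis .
  qed
  moreover have "test_function (\<lambda>x. r * g (\<delta> r x))"
    using test_function_scaleR[OF test_function_compose[OF g_test \<delta>], of r] by simp
  ultimately show ?thesis by (simp add: is_div_h_def)
qed

text \<open>
  The perimeter of the ball of radius \<open>r\<close> is \<open>J / r\<close> times that of the unit ball, where \<open>J = 1 / c\<close> is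
  the factor by which \<open>\<delta> r\<close> multiplies volume (in fact \<open>J = r\<^sup>Q\<close>). The estimate
  \<open>J \<le> (2 C r)\<^sup>d\<close> with \<open>d = DIM('a) \<ge> 1\<close> suffices: it keeps \<open>J / r\<close> bounded, also for \<open>r \<rightarrow> 0\<close>.
\<close>

lemma gauge_ball_perimeter_bound:
  assumes N: "is_gauge \<delta> N" and R: "R > 0"
    and P: "\<And>F g. test_function F \<Longrightarrow> (\<forall>x. norm (F x) \<le> 1) \<Longrightarrow> is_div_h mul e F g \<Longrightarrow>
      (\<integral>x. indicator (gauge_ball N 1) x * g x \<partial>lebesgue) \<le> P"
  obtains M where "M \<ge> 0"
    "\<And>r F g. 0 < r \<Longrightarrow> r \<le> R \<Longrightarrow>
      test_function F \<Longrightarrow> (\<forall>x. norm (F x) \<le> 1) \<Longrightarrow> is_div_h mul e F g \<Longrightarrow>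
      (\<integral>x. indicator (gauge_ball N r) x * g x \<partial>lebesgue) \<le> M"
proof -
  obtain C where C: "C > 0"
    "\<And>r v. 0 < r \<Longrightarrow> r \<le> R \<Longrightarrow> norm (frechet_derivative (\<delta> r) (at 0) v) \<le> C * r * norm v"
    using dilation_derivative_bound[OF R] by blast
  obtain n where n: "DIM('a) = Suc n"
    using DIM_positive[where 'a = 'a] gr0_implies_Suc by blast
  have P0: "0 \<le> P"
    using P[of "\<lambda>x. 0" "\<lambda>x. 0"] by (simp add: is_div_h_def test_function_zero)
  define M where "M = (2 * C) ^ DIM('a) * R ^ n * P"
  have "(\<integral>x. indicator (gauge_ball N r) x * g x \<partial>lebesgue) \<le> M"
    if r: "0 < r" "r \<le> R" and F: "test_function F" "\<forall>x. norm (F x) \<le> 1" and g: "is_div_h mul e F g"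
    for r F g
  proof -
    note aut = dilation_automorphism[OF r(1)]
    then have \<delta>: "smooth (\<delta> r)" "bij (\<delta> r)" "smooth (inv (\<delta> r))"
      by (auto simp: is_group_automorphism_def)
    obtain c where c: "c > 0" "distr lborel borel (\<delta> r) = density lborel (\<lambda>_. ennreal c)"
      using automorphism_scales_haar[OF aut] .
    have [measurable]: "g \<in> borel_measurable borel"
      using g smooth_imp_borel by (auto simp: is_div_h_def test_function_def)
    note [measurable] = gauge_ball_borel[OF N]
    have ind: "indicator (gauge_ball N r) (\<delta> r x) = (indicator (gauge_ball N 1) x :: real)" for x
      using N r by (simp add: is_gauge_def gauge_ball_def indicator_def)
    have "r * c * (\<integral>x. indicator (gauge_ball N r) x * g x \<partial>lebesgue)
        = r * (\<integral>x. indicator (gauge_ball N 1) x * g (\<delta> r x) \<partial>lebesgue)"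
      using automorphism_integral[OF aut c, of "\<lambda>x. indicator (gauge_ball N r) x * g x"]
      by (simp add: ind)
    also have "\<dots> = (\<integral>x. indicator (gauge_ball N 1) x * (r * g (\<delta> r x)) \<partial>lebesgue)"
      by (subst integral_mult_right_zero[symmetric]) (simp add: mult_ac)
    also have "\<dots> \<le> P"
      using F by (intro P[OF test_function_compose[OF F(1) \<delta>] _ is_div_h_dilation[OF r(1) F(1) g]]) auto
    finally have "r * c * (\<integral>x. indicator (gauge_ball N r) x * g x \<partial>lebesgue) \<le> P" .
    then have "(\<integral>x. indicator (gauge_ball N r) x * g x \<partial>lebesgue) \<le> P / (r * c)"
      using r c by (simp add: pos_le_divide_eq mult_ac)
    also have "\<dots> \<le> M"
    proof -
      have "1 \<le> c * (2 * (C * r)) ^ DIM('a)"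
        by (rule automorphism_scaling_lower_bound[OF aut c]) (use C r in auto)
      also have "\<dots> = (r * c) * ((2 * C) ^ DIM('a) * r ^ n)"
        by (simp add: n power_mult_distrib)
      also have "\<dots> \<le> (r * c) * ((2 * C) ^ DIM('a) * R ^ n)"
        using r c C by (intro mult_left_mono power_mono) auto
      finally have "1 * P \<le> (r * c) * ((2 * C) ^ DIM('a) * R ^ n) * P"
        using P0 by (rule mult_right_mono)
      then have "P \<le> (r * c) * M" by (simp add: M_def mult.assoc)
      then show ?thesis using r c by (simp add: pos_divide_le_eq mult_ac)
    qed
    finally show ?thesis .
  qed
  moreover have "M \<ge> 0"
    using C R P0 by (simp add: M_def)
  ultimately show ?thesis using that by blast
qed

end

section \<open>Superlevel sets of the rearrangement\<close>

text \<open>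
  Discretised layer-cake formula: summing the indicators of the superlevel sets at the heights
  \<open>0, h, 2h, \<dots>\<close> below \<open>C\<close>, each with weight \<open>h = C / n\<close>, approximates \<open>w\<close> uniformly to within \<open>h\<close>.
\<close>

lemma integral_layer_cake_bound:
  fixes w g :: "'a \<Rightarrow> real"
  assumes w [measurable]: "w \<in> borel_measurable M" and range: "\<And>x. 0 \<le> w x" "\<And>x. w x \<le> C"
    and g: "integrable M g"
    and bound: "\<And>t. t \<ge> 0 \<Longrightarrow> (\<integral>x. indicator {x. t < w x} x * g x \<partial>M) \<le> B"
    and C: "C > 0"
  shows "(\<integral>x. w x * g x \<partial>M) \<le> C * B"
proof (rule field_le_epsilon)
  fix \<epsilon> :: real assume \<epsilon>: "\<epsilon> > 0"
  have [measurable]: "g \<in> borel_measurable M"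
    using g by (rule borel_measurable_integrable)
  define a where "a = (\<integral>x. \<bar>g x\<bar> \<partial>M)"
  obtain n :: nat where "C * a / \<epsilon> < real n"
    using reals_Archimedean2 by blast
  moreover have "C * a / \<epsilon> \<ge> 0"
    using C \<epsilon> by (simp add: a_def)
  ultimately have "real n > 0" and an: "C * a \<le> \<epsilon> * real n"
    using \<epsilon> by (linarith, simp add: pos_divide_less_eq mult.commute)
  then have n: "n > 0" "C / n * a \<le> \<epsilon>"
    by (simp_all add: pos_divide_le_eq)
  define h where "h = C / n"
  have h: "h > 0" "real n * h = C"
    using C n by (simp_all add: h_def)
  define s where "s x = (\<Sum>i<n. h * indicator {x. real i * h < w x} x)" for x
  have close: "\<bar>w x - s x\<bar> \<le> h" for x
  proof -
    define y where "y = w x / h"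
    have y: "0 \<le> y" "y \<le> real n" "w x = h * y"
      using range[of x] h by (simp_all add: y_def field_simps)
    \<comment> \<open>The sum counts the heights below \<open>w x\<close>, that is, it rounds \<open>w x\<close> up to a multiple of \<open>h\<close>.\<close>
    have "{i. i < n \<and> real i * h < w x} = {..<nat \<lceil>y\<rceil>}"
    proof (intro set_eqI)
      fix i
      have "real i * h < w x \<longleftrightarrow> real i < y"
        using h by (simp add: y_def field_simps)
      also have "\<dots> \<longleftrightarrow> i < nat \<lceil>y\<rceil>"
        by (simp add: zless_nat_eq_int_zless less_ceiling_iff)
      finally show "i \<in> {i. i < n \<and> real i * h < w x} \<longleftrightarrow> i \<in> {..<nat \<lceil>y\<rceil>}"
        using y(2) by (auto simp: zless_nat_eq_int_zless less_ceiling_iff)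
    qed
    then have "card {i. i < n \<and> real i * h < w x} = nat \<lceil>y\<rceil>"
      by simp
    moreover have "s x = h * real (card {i. i < n \<and> real i * h < w x})"
      unfolding s_def sum_distrib_left[symmetric]
      by (simp add: indicator_def sum.If_cases Int_def lessThan_def)
    ultimately have "s x - w x = h * (real (nat \<lceil>y\<rceil>) - y)"
      using y(3) by (simp add: algebra_simps)
    moreover have "0 \<le> real (nat \<lceil>y\<rceil>) - y" "real (nat \<lceil>y\<rceil>) - y \<le> 1"
      using y(1) by linarith+
    ultimately show ?thesis
      using h by (simp add: abs_minus_commute[of "w x"] abs_mult)
  qed
  have int_level: "integrable M (\<lambda>x. indicator {x. t < w x} x * g x)" for t
    by (rule Bochner_Integration.integrable_bound[OF g]) (auto simp: indicator_def)
  have s_eq: "s x * g x = (\<Sum>i<n. h * (indicator {x. real i * h < w x} x * g x))" for x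
    by (simp only: s_def sum_distrib_right mult.assoc)
  have int_s: "integrable M (\<lambda>x. s x * g x)"
    unfolding s_eq by (intro Bochner_Integration.integrable_sum integrable_mult_right int_level)
  have int_w: "integrable M (\<lambda>x. w x * g x)"
  proof (rule Bochner_Integration.integrable_bound)
    show "integrable M (\<lambda>x. C * \<bar>g x\<bar>)" using g by simp
    show "AE x in M. norm (w x * g x) \<le> norm (C * \<bar>g x\<bar>)"
      using range C by (intro AE_I2) (simp add: abs_mult mult_right_mono)
  qed simp
  have "(\<integral>x. w x * g x \<partial>M) - (\<integral>x. s x * g x \<partial>M) = (\<integral>x. (w x - s x) * g x \<partial>M)"
    using int_w int_s by (simp add: left_diff_distrib)
  also have "\<dots> \<le> (\<integral>x. h * \<bar>g x\<bar> \<partial>M)"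
  proof (rule integral_mono)
    show "integrable M (\<lambda>x. (w x - s x) * g x)"
      using int_w int_s by (simp add: left_diff_distrib)
    show "integrable M (\<lambda>x. h * \<bar>g x\<bar>)" using g by simp
    show "(w x - s x) * g x \<le> h * \<bar>g x\<bar>" for x
      using mult_right_mono[OF close[of x], of "\<bar>g x\<bar>"] by (simp flip: abs_mult)
  qed
  also have "\<dots> \<le> \<epsilon>"
    using n(2) by (simp add: a_def h_def)
  finally have "(\<integral>x. w x * g x \<partial>M) \<le> (\<integral>x. s x * g x \<partial>M) + \<epsilon>"
    by simp
  also have "(\<integral>x. s x * g x \<partial>M) = (\<Sum>i<n. h * (\<integral>x. indicator {x. real i * h < w x} x * g x \<partial>M))"
    unfolding s_eq
    by (subst Bochner_Integration.integral_sum) (simp_all add: int_level)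
  also have "\<dots> \<le> (\<Sum>i<n. h * B)"
    using h by (intro sum_mono mult_left_mono bound) auto
  also have "\<dots> = C * B"
    using h by (simp add: mult.assoc[symmetric])
  finally show "(\<integral>x. w x * g x \<partial>M) \<le> C * B + \<epsilon>" by simp
qed

text \<open>
  A nonempty superlevel set is closed downwards and bounded above by \<open>R\<close>, so its supremum \<open>\<rho>\<close>
  determines it up to membership of \<open>\<rho>\<close> itself.
\<close>

lemma antimono_superlevel:
  fixes f :: "real \<Rightarrow> real"
  assumes f: "antimono f" and R: "\<And>r. r \<ge> R \<Longrightarrow> f r \<le> t" and ne: "{r. t < f r} \<noteq> {}"
  obtains \<rho> where "\<rho> \<le> R" "{r. t < f r} = {..<\<rho>} \<or> {r. t < f r} = {..\<rho>}"
proof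
  let ?S = "{r. t < f r}" let ?\<rho> = "Sup ?S"
  have le: "r \<le> R" if "r \<in> ?S" for r
    using that R[of r] by (auto simp: not_less[symmetric])
  then have bdd: "bdd_above ?S" by (auto simp: bdd_above_def)
  show "?\<rho> \<le> R" using le ne by (intro cSup_least) auto
  have down: "r \<in> ?S" if r: "r < ?\<rho>" for r
  proof -
    obtain s where "s \<in> ?S" "r < s" using less_cSupE[OF r ne] by blast
    then show ?thesis using antimonoD[OF f, of r s] by simp
  qed
  have up: "r \<le> ?\<rho>" if "r \<in> ?S" for r
    using cSup_upper[OF that bdd] .
  show "?S = {..<?\<rho>} \<or> ?S = {..?\<rho>}"
  proof (cases "?\<rho> \<in> ?S")
    case True
    have "?S = {..?\<rho>}"
    proof (intro equalityI subsetI)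
      fix r assume "r \<in> {..?\<rho>}"
      then show "r \<in> ?S" using down[of r] True by (cases "r = ?\<rho>") auto
    qed (use up in auto)
    then show ?thesis ..
  next
    case False
    have "?S = {..<?\<rho>}"
    proof (intro equalityI subsetI)
      fix r assume r: "r \<in> ?S"
      with False have "r \<noteq> ?\<rho>" by metis
      with up[OF r] show "r \<in> {..<?\<rho>}" by simp
    qed (use down in auto)
    then show ?thesis ..
  qed
qed

lemma borel_measurable_antimono:
  fixes f :: "real \<Rightarrow> real"
  assumes "antimono f"
  shows "f \<in> borel_measurable borel"
proof -
  have "(\<lambda>x. - f x) \<in> borel_measurable borel"
    using assms by (intro borel_measurable_mono monoI) (simp add: antimonoD)
  then show ?thesis by simp
qed

lemma level_function_antimono_bounded:
  assumes "\<And>r. gauge_ball N r \<in> sets lebesgue"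
    and C: "\<And>t. 0 \<le> t \<Longrightarrow> 0 < emeasure lebesgue {x. u x > t} \<Longrightarrow> t \<le> C"
  shows "antimono (level_function N u)" "\<And>r. 0 \<le> level_function N u r"
    "\<And>r. 0 \<le> C \<Longrightarrow> level_function N u r \<le> C"
proof -
  define T where "T r = {t. 0 \<le> t \<and> emeasure lebesgue {x. u x > t} > emeasure lebesgue (gauge_ball N r)}" for r
  have level: "level_function N u r = (if T r = {} then 0 else Sup (T r))" for r
    by (simp only: level_function_def T_def Let_def)
  have T: "0 \<le> t" "t \<le> C" if "t \<in> T r" for t r
    using that C[of t] by (auto simp: T_def intro: le_less_trans[OF zero_le])
  then have bdd: "bdd_above (T r)" for r
    by (intro bdd_aboveI[of _ C])
  show nonneg: "0 \<le> level_function N u r" for r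
  proof (cases "T r = {}")
    case False
    then obtain t where t: "t \<in> T r" by blast
    then have "0 \<le> Sup (T r)" using T(1)[OF t] cSup_upper2[OF t _ bdd] by blast
    then show ?thesis by (simp add: level)
  qed (simp add: level)
  show "level_function N u r \<le> C" if "0 \<le> C" for r
    unfolding level using T that by (simp add: cSup_least)
  show "antimono (level_function N u)"
  proof (rule antimonoI)
    fix r s :: real assume "r \<le> s"
    then have "emeasure lebesgue (gauge_ball N r) \<le> emeasure lebesgue (gauge_ball N s)"
      using assms(1) by (intro emeasure_mono) (auto simp: gauge_ball_def)
    then have sub: "T s \<subseteq> T r" by (auto simp: T_def)
    show "level_function N u s \<le> level_function N u r"
    proof (cases "T s = {}")
      case True
      then show ?thesis using nonneg[of r] by (simp add: level)
    next
      case False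
      then show ?thesis
        using sub cSup_subset_mono[OF False bdd sub] by (auto simp: level)
    qed
  qed
qed

lemma level_function_eq_0:
  assumes "\<And>t. 0 \<le> t \<Longrightarrow> emeasure lebesgue {x. u x > t} \<le> emeasure lebesgue (gauge_ball N r)"
  shows "level_function N u r = 0"
proof -
  have "{t. 0 \<le> t \<and> emeasure lebesgue {x. u x > t} > emeasure lebesgue (gauge_ball N r)} = {}"
    using assms by (auto simp: not_less)
  then show ?thesis by (simp only: level_function_def Let_def refl if_True)
qed

text \<open>
  The gauge balls exhaust the space, which has infinite measure.
\<close>

lemma gauge_ball_exceeds:
  assumes N: "is_gauge \<delta> N" and c: "c < \<infinity>"
  obtains R where "R > 0" "\<And>r. r \<ge> R \<Longrightarrow> c \<le> emeasure lebesgue (gauge_ball N r)"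
proof -
  have sets: "gauge_ball N r \<in> sets lebesgue" for r
    using gauge_ball_borel[OF N, of r] by simp
  have "(\<lambda>n. emeasure lebesgue (gauge_ball N (real n))) \<longlonglongrightarrow> emeasure lebesgue (\<Union>n. gauge_ball N (real n))"
    using sets by (intro Lim_emeasure_incseq) (auto simp: incseq_def gauge_ball_def)
  also have "(\<Union>n. gauge_ball N (real n)) = UNIV"
    using reals_Archimedean2 by (auto simp: gauge_ball_def)
  finally have "eventually (\<lambda>n. c < emeasure lebesgue (gauge_ball N (real n))) sequentially"
    using c by (intro order_tendstoD) auto
  then obtain n where n: "c < emeasure lebesgue (gauge_ball N (real n))"
    by (auto simp: eventually_sequentially)
  show thesis
  proof
    show "real n + 1 > 0" by simp
    fix r assume "r \<ge> real n + 1"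
    then have "emeasure lebesgue (gauge_ball N (real n)) \<le> emeasure lebesgue (gauge_ball N r)"
      using sets by (intro emeasure_mono) (auto simp: gauge_ball_def)
    with n show "c \<le> emeasure lebesgue (gauge_ball N r)" by simp
  qed
qed

text \<open>
  The closed ball is the intersection of the open balls of slightly larger radius. Passing to the limit
  in the integrals by dominated convergence transfers the bound to it.
\<close>

lemma closed_gauge_ball_integral_bound:
  fixes g :: "'a::euclidean_space \<Rightarrow> real"
  assumes N: "is_gauge \<delta> N" and g: "integrable lebesgue g" and \<rho>: "0 \<le> \<rho>"
    and bound: "\<And>r. \<rho> < r \<Longrightarrow> r \<le> \<rho> + 1 \<Longrightarrow> (\<integral>x. indicator (gauge_ball N r) x * g x \<partial>lebesgue) \<le> M"
  shows "(\<integral>x. indicator {x. N x \<le> \<rho>} x * g x \<partial>lebesgue) \<le> M"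
proof (rule LIMSEQ_le_const2)
  note [measurable] = borel_measurable_integrable[OF g]
  have [measurable]: "N \<in> borel_measurable lebesgue"
    using N by (auto simp: is_gauge_def borel_measurable_continuous_onI intro!: measurable_completion)
  define r where "r n = \<rho> + 1 / real (Suc n)" for n
  have r: "r \<longlonglongrightarrow> \<rho>"
    unfolding r_def using tendsto_add[OF tendsto_const[of \<rho>] LIMSEQ_Suc[OF lim_1_over_n]] by simp
  show "(\<lambda>n. \<integral>x. indicator (gauge_ball N (r n)) x * g x \<partial>lebesgue)
      \<longlonglongrightarrow> (\<integral>x. indicator {x. N x \<le> \<rho>} x * g x \<partial>lebesgue)"
  proof (rule integral_dominated_convergence)
    show "integrable lebesgue (\<lambda>x. \<bar>g x\<bar>)" using g by simp
    show "AE x in lebesgue. (\<lambda>n. indicator (gauge_ball N (r n)) x * g x)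
        \<longlonglongrightarrow> indicator {x. N x \<le> \<rho>} x * g x"
    proof (intro AE_I2 tendsto_mult tendsto_const)
      fix x
      have "eventually (\<lambda>n. indicator (gauge_ball N (r n)) x = (indicator {x. N x \<le> \<rho>} x :: real)) sequentially"
      proof (cases "N x \<le> \<rho>")
        case True
        moreover have "\<rho> < r n" for n by (simp add: r_def)
        ultimately have "N x < r n" for n by (meson le_less_trans)
        then show ?thesis using True by (simp add: gauge_ball_def)
      next
        case False
        then have "eventually (\<lambda>n. r n < N x) sequentially"
          using r by (intro order_tendstoD) auto
        then show ?thesis
          by eventually_elim (use False in \<open>simp add: gauge_ball_def indicator_def\<close>)
      qed
      then show "(\<lambda>n. indicator (gauge_ball N (r n)) x :: real) \<longlonglongrightarrow> indicator {x. N x \<le> \<rho>} x"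
        by (rule tendsto_eventually)
    qed
  qed (auto simp: gauge_ball_def indicator_def)
  show "\<exists>n0. \<forall>n\<ge>n0. (\<integral>x. indicator (gauge_ball N (r n)) x * g x \<partial>lebesgue) \<le> M"
    using bound by (auto simp: r_def)
qed

section \<open>Bounded variation of the rearrangement\<close>

theorem theorem3p2:
  fixes mul :: "'a::euclidean_space \<Rightarrow> 'a \<Rightarrow> 'a"
    and ginv :: "'a \<Rightarrow> 'a"
    and k :: nat
    and V :: "nat \<Rightarrow> 'a set"
    and e :: "'m::finite \<Rightarrow> 'a"
    and \<delta> :: "real \<Rightarrow> 'a \<Rightarrow> 'a"
    and N :: "'a \<Rightarrow> real"
    and u :: "'a \<Rightarrow> real"
  assumes "carnot_group mul ginv k V e \<delta>"
    and "is_gauge \<delta> N"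
    and "perimeter_h mul e (gauge_ball N 1) < \<infinity>"
    and "u \<in> borel_measurable lebesgue"
    and "\<exists>C. AE x in lebesgue. \<bar>u x\<bar> \<le> C"
    and "AE x in lebesgue. 0 \<le> u x"
    and "\<exists>K. compact K \<and> (AE x in lebesgue. x \<notin> K \<longrightarrow> u x = 0)"
  shows "rearrangement N u \<in> BV_h mul e"
proof -
  interpret carnot_group mul ginv k V e \<delta> by fact
  note N = assms(2) and [measurable] = assms(4)
  have N_pos: "0 \<le> N x" for x using N by (simp add: is_gauge_def)
  have [measurable]: "N \<in> borel_measurable borel"
    using N by (simp add: is_gauge_def borel_measurable_continuous_onI)
  obtain C\<^sub>0 where C\<^sub>0: "AE x in lebesgue. \<bar>u x\<bar> \<le> C\<^sub>0" using assms(5) by blast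
  define C where "C = max 1 C\<^sub>0"
  have C: "C > 0" by (simp add: C_def)
  have levels_bounded: "t \<le> C" if "0 < emeasure lebesgue {x. u x > t}" for t
  proof (rule ccontr)
    assume "\<not> t \<le> C"
    then have "AE x in lebesgue. \<not> u x > t"
      using C\<^sub>0 by (auto elim!: eventually_mono simp: C_def)
    then have "emeasure lebesgue {x \<in> space lebesgue. u x > t} = 0"
      by (rule emeasure_eq_0_AE)
    with that show False by simp
  qed
  obtain K where K: "compact K" "AE x in lebesgue. x \<notin> K \<longrightarrow> u x = 0" using assms(7) by blast
  have level_measure: "emeasure lebesgue {x. u x > t} \<le> emeasure lebesgue K" if "0 \<le> t" for t
    using K that by (intro emeasure_mono_AE) (auto elim!: eventually_mono intro: lmeasurable_compact fmeasurableD)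
  have "emeasure lebesgue K < \<infinity>"
    using K(1) lmeasurable_compact fmeasurableD2 by (auto simp: top.not_eq_extremum[symmetric])
  then obtain R where R: "R > 0"
    "\<And>r. r \<ge> R \<Longrightarrow> emeasure lebesgue K \<le> emeasure lebesgue (gauge_ball N r)"
    using gauge_ball_exceeds[OF N] by blast
  define f where "f = level_function N u"
  have ball_sets: "gauge_ball N r \<in> sets lebesgue" for r
    using gauge_ball_borel[OF N, of r] by simp
  have f: "antimono f" "\<And>r. 0 \<le> f r" "\<And>r. f r \<le> C"
    using level_function_antimono_bounded[OF ball_sets levels_bounded] C unfolding f_def by auto
  have f_outside: "f r = 0" if "r \<ge> R" for r
    unfolding f_def using level_function_eq_0 level_measure R(2)[OF that] order_trans by blast
  have [measurable]: "f \<in> borel_measurable borel"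
    by (rule borel_measurable_antimono[OF f(1)])
  define w where "w = rearrangement N u"
  have w: "w x = f (N x)" for x
    by (simp add: w_def f_def rearrangement_def)
  have "(\<lambda>x. f (N x)) \<in> borel_measurable borel" by measurable
  then have w_meas [measurable]: "w \<in> borel_measurable lebesgue"
    by (auto simp: w[abs_def] intro: measurable_completion)
  have "locally_integrable w"
    unfolding locally_integrable_def set_integrable_def
  proof (intro allI impI)
    fix A :: "'a set" assume "compact A"
    then have A: "A \<in> lmeasurable" by (rule lmeasurable_compact)
    show "integrable lebesgue (\<lambda>x. indicator A x *\<^sub>R w x)"
    proof (rule Bochner_Integration.integrable_bound)
      show "integrable lebesgue (\<lambda>x. C * indicator A x)"
        using A by (intro integrable_mult_right integrable_real_indicator) (auto simp: fmeasurable_def)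
      show "AE x in lebesgue. norm (indicator A x *\<^sub>R w x) \<le> norm (C * indicator A x)"
        using f C by (intro AE_I2) (auto simp: w indicator_def)
    qed (use A in \<open>measurable\<close>)
  qed
  moreover have "bv_h_norm mul e w < \<infinity>"
  proof -
    define p where "p = perimeter_h mul e (gauge_ball N 1)"
    have p: "ereal (\<integral>x. indicator (gauge_ball N 1) x * g x \<partial>lebesgue) \<le> p"
      if "test_function F" "\<forall>x. norm (F x) \<le> 1" "is_div_h mul e F g" for F g
      unfolding p_def perimeter_h_def bv_h_norm_def using that by (intro Sup_upper) blast
    have "0 \<le> p"
      using p[of "\<lambda>x. 0" "\<lambda>x. 0"] by (simp add: is_div_h_def test_function_zero flip: zero_ereal_def)
    then obtain P where P: "p = ereal P"
      using assms(3) unfolding p_def[symmetric] by (cases p) auto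
    \<comment> \<open>The radii go up to \<open>R + 1\<close> so that closed balls of radius at most \<open>R\<close> can be approximated from outside.\<close>
    obtain M where M: "M \<ge> 0"
      "\<And>r F g. 0 < r \<Longrightarrow> r \<le> R + 1 \<Longrightarrow>
        test_function F \<Longrightarrow> (\<forall>x. norm (F x) \<le> 1) \<Longrightarrow> is_div_h mul e F g \<Longrightarrow>
        (\<integral>x. indicator (gauge_ball N r) x * g x \<partial>lebesgue) \<le> M"
      using gauge_ball_perimeter_bound[OF N, of "R + 1" P] p P R(1) by auto
    have "(\<integral>x. w x * g x \<partial>lebesgue) \<le> C * M"
      if F: "test_function F" "\<forall>x. norm (F x) \<le> 1" and g: "is_div_h mul e F g" for F g
    proof (rule integral_layer_cake_bound[OF w_meas _ _ _ _ C])
      have "integrable lborel g"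
        using g by (intro test_function_integrable) (simp add: is_div_h_def)
      then show int: "integrable lebesgue g"
        by (simp add: integrable_completion borel_measurable_integrable)
      show "0 \<le> w x" "w x \<le> C" for x using f by (simp_all add: w)
      fix t :: real assume t: "0 \<le> t"
      show "(\<integral>x. indicator {x. t < w x} x * g x \<partial>lebesgue) \<le> M"
      proof (cases "{r. t < f r} = {}")
        case True
        then show ?thesis using M(1) by (simp add: w)
      next
        case False
        have "f r \<le> t" if "r \<ge> R" for r using f_outside[OF that] t by simp
        from antimono_superlevel[OF f(1) this False] obtain \<rho> where \<rho>: "\<rho> \<le> R"
          "{r. t < f r} = {..<\<rho>} \<or> {r. t < f r} = {..\<rho>}" .
        from \<rho>(2) show ?thesis
        proof
          assume "{r. t < f r} = {..<\<rho>}"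
          then have eq: "{x. t < w x} = gauge_ball N \<rho>"
            by (auto simp: w gauge_ball_def)
          show ?thesis
          proof (cases "\<rho> > 0")
            case True
            then show ?thesis unfolding eq using M(2)[OF _ _ F g] \<rho>(1) by simp
          next
            case False
            then have "gauge_ball N \<rho> = {}"
              using N_pos by (auto simp: gauge_ball_def not_less intro: order_trans)
            then show ?thesis unfolding eq using M(1) by simp
          qed
        next
          assume "{r. t < f r} = {..\<rho>}"
          then have eq: "{x. t < w x} = {x. N x \<le> \<rho>}"
            by (auto simp: w)
          show ?thesis
          proof (cases "\<rho> \<ge> 0")
            case True
            then show ?thesis unfolding eq
              by (intro closed_gauge_ball_integral_bound[OF N int] M(2)[OF _ _ F g]) (use \<rho>(1) in auto)
          next
            case False
            then have "{x. N x \<le> \<rho>} = {}"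
              using N_pos by (auto simp: not_le intro: less_le_trans)
            then show ?thesis unfolding eq using M(1) by simp
          qed
        qed
      qed
    qed
    then have "bv_h_norm mul e w \<le> ereal (C * M)"
      unfolding bv_h_norm_def by (intro Sup_least) auto
    then show ?thesis by (rule le_less_trans) simp
  qed
  ultimately show ?thesis by (simp add: BV_h_def w_def)
qed

end
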